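(* Let $D=(V,A)$ be a minimal strong digraph and let $u,w\in V$ be vertices with $uw\notin A$ (here $u\neq w$, since digraphs have no loops). Let $v\notin V$ and let $e_{uw}(D)=(V\cup\{v\},\,A\cup\{uv,vw\})$ be the external expansion of $D$ by $v$ from $u$ to $w$. Then $e_{uw}(D)$ is a minimal strong digraph if and only if the digraph $D+uw=(V,A\cup\{uw\})$ has no transitive arcs other than $uw$.
   Context: A digraph is a pair $D=(V,A)$ with $V$ a finite nonempty set and $A\subseteq V\times V\setminus\{(x,x):x\in V\}$; the arc $(x,y)$ is written $xy$. $D+xy$ denotes $(V,A\cup\{xy\})$ and $D-xy$ denotes $(V,A\setminus\{xy\})$. A digraph is strong (strongly connected) if for every ordered pair of vertices $x,y$ there is a directed path from $x$ to $y$. A strong digraph $D$ is minimal strong if $D-a$ is not strong for every arc $a\in A$. An arc $xy$ of a digraph is transitive if there is a directed $x$–$y$ path in the digraph other than the arc $xy$ itself. *)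

theory Defs
  imports "Graph_Theory.Graph_Theory"
begin

text \<open>
  Digraphs are finite, loop-free and have pairs of vertices as arcs, so they are the
  \<^typ>\<open>'a pair_pre_digraph\<close>s satisfying \<^const>\<open>pair_digraph\<close>. That locale admits the null
  graph; \<^const>\<open>strongly_connected\<close> excludes it.
\<close>

definition add_parc :: "'a pair_pre_digraph \<Rightarrow> 'a \<times> 'a \<Rightarrow> 'a pair_pre_digraph" where
  "add_parc D a = \<lparr> pverts = pverts D, parcs = parcs D \<union> {a} \<rparr>"

definition del_parc :: "'a pair_pre_digraph \<Rightarrow> 'a \<times> 'a \<Rightarrow> 'a pair_pre_digraph" where
  "del_parc D a = \<lparr> pverts = pverts D, parcs = parcs D - {a} \<rparr>"

definition minimal_strong :: "'a pair_pre_digraph \<Rightarrow> bool" where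
  "minimal_strong D \<longleftrightarrow>
     pair_digraph D \<and> strongly_connected (with_proj D) \<and>
     (\<forall>a \<in> parcs D. \<not> strongly_connected (with_proj (del_parc D a)))"

definition transitive_arc :: "'a pair_pre_digraph \<Rightarrow> 'a \<times> 'a \<Rightarrow> bool" where
  "transitive_arc D a \<longleftrightarrow>
     a \<in> parcs D \<and> (\<exists>p. pre_digraph.apath (with_proj D) (fst a) p (snd a) \<and> p \<noteq> [a])"

definition external_expansion ::
  "'a pair_pre_digraph \<Rightarrow> 'a \<Rightarrow> 'a \<Rightarrow> 'a \<Rightarrow> 'a pair_pre_digraph" where
  "external_expansion D u w v =
     \<lparr> pverts = pverts D \<union> {v}, parcs = parcs D \<union> {(u, v), (v, w)} \<rparr>"

end

theory Submission
  imports Defs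
begin

text \<open>
  A strong digraph is minimal strong iff it has no transitive arcs, and an arc \<open>xy\<close> is transitive
  iff \<open>y\<close> is still reachable from \<open>x\<close> after deleting \<open>xy\<close>. In the expansion, \<open>uv\<close> is the only arc
  entering \<open>v\<close> and \<open>vw\<close> the only arc leaving it, so neither is transitive. Between vertices
  of \<open>D\<close> the detour \<open>u, v, w\<close> and the arc \<open>uw\<close> give the same reachability, even after an arc
  of \<open>D\<close> has been deleted, so an arc of \<open>D\<close> is transitive in the expansion iff it is transitive
  in \<open>D + uw\<close>.
\<close>

lemma (in wf_digraph) reachable_image:
  assumes reach: "x \<rightarrow>\<^sup>* y" and H: "wf_digraph H"
    and verts: "\<And>z. z \<in> verts G \<Longrightarrow> f z \<in> verts H"
    and arcs: "\<And>y z. y \<rightarrow>\<^bsub>G\<^esub> z \<Longrightarrow> f y \<rightarrow>\<^sup>*\<^bsub>H\<^esub> f z"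
  shows "f x \<rightarrow>\<^sup>*\<^bsub>H\<^esub> f y"
  using reach
proof (induction rule: reachable_induct)
  case base
  then show ?case using H verts by (simp add: wf_digraph.reachable_refl)
next
  case (step y z)
  from step.IH arcs[OF step.hyps(2)] show ?case by (rule wf_digraph.reachable_trans[OF H])
qed

lemma (in wf_digraph) reachable_if_arcs_reachable:
  assumes reach: "x \<rightarrow>\<^sup>* y" and H: "wf_digraph H"
    and verts: "verts G \<subseteq> verts H"
    and arcs: "\<And>y z. y \<rightarrow>\<^bsub>G\<^esub> z \<Longrightarrow> y \<rightarrow>\<^sup>*\<^bsub>H\<^esub> z"
  shows "x \<rightarrow>\<^sup>*\<^bsub>H\<^esub> y"
  using reachable_image[OF reach H, where f = "\<lambda>z. z"] verts arcs by auto

lemma (in wf_digraph) apath_eq_arc_if_arc_mem: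
  assumes path: "apath (tail G a) p (head G a)" and "a \<in> set p"
  shows "p = [a]"
proof -
  obtain q r where decomp: "p = q @ a # r"
    using \<open>a \<in> set p\<close> by (auto simp: in_set_conv_decomp)
  with path have "apath (tail G a) q (tail G a)" "apath (head G a) r (head G a)"
    by (auto simp: apath_append_iff apath_Cons_iff)
  then have "q = []" "r = []"
    using apath_nonempty_ends by blast+
  with decomp show ?thesis by simp
qed

lemma (in wf_digraph) reachable_del_arc_iff_other_apath:
  "tail G a \<rightarrow>\<^sup>*\<^bsub>del_arc a\<^esub> head G a \<longleftrightarrow> (\<exists>p. apath (tail G a) p (head G a) \<and> p \<noteq> [a])"
proof -
  interpret H: wf_digraph "del_arc a" by (rule wf_digraph_del_arc)
  have "H.apath (tail G a) p (head G a) \<longleftrightarrow> apath (tail G a) p (head G a) \<and> p \<noteq> [a]" for p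
  proof
    assume path: "H.apath (tail G a) p (head G a)"
    then have "p \<noteq> [a]" by (auto simp: H.apath_Cons_iff)
    with path show "apath (tail G a) p (head G a) \<and> p \<noteq> [a]"
      using subgraph_apath_imp_apath subgraph_del_arc by blast
  next
    assume path: "apath (tail G a) p (head G a) \<and> p \<noteq> [a]"
    then have "a \<notin> set p" using apath_eq_arc_if_arc_mem by blast
    moreover have compatible: "compatible G (del_arc a)"
      using subgraph_del_arc by (rule subgraphE)
    ultimately show "H.apath (tail G a) p (head G a)"
      using path by (auto simp: apath_def awalk_def H.apath_def H.awalk_def
          compatible_cas[OF compatible] compatible_awalk_verts[OF compatible])
  qed
  then show ?thesis by (simp add: H.reachable_apath)
qed

lemma (in wf_digraph) strongly_connected_del_arc_iff:
  assumes strong: "strongly_connected G" and arc: "a \<in> arcs G"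
  shows "strongly_connected (del_arc a) \<longleftrightarrow> tail G a \<rightarrow>\<^sup>*\<^bsub>del_arc a\<^esub> head G a"
proof
  assume "strongly_connected (del_arc a)"
  with arc show "tail G a \<rightarrow>\<^sup>*\<^bsub>del_arc a\<^esub> head G a"
    by (simp add: strongly_connected_def)
next
  interpret H: wf_digraph "del_arc a" by (rule wf_digraph_del_arc)
  assume detour: "tail G a \<rightarrow>\<^sup>*\<^bsub>del_arc a\<^esub> head G a"
  have "y \<rightarrow>\<^sup>*\<^bsub>del_arc a\<^esub> z" if "y \<rightarrow>\<^bsub>G\<^esub> z" for y z
  proof -
    obtain b where b_arc: "b \<in> arcs G" "tail G b = y" "head G b = z"
      using \<open>y \<rightarrow>\<^bsub>G\<^esub> z\<close> by (rule reachableE)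
    show ?thesis
    proof (cases "b = a")
      case True
      with b_arc detour show ?thesis by simp
    next
      case False
      with b_arc have "y \<rightarrow>\<^bsub>del_arc a\<^esub> z" by (auto simp: arcs_ends_conv)
      then show ?thesis by (rule H.reachable_adjI)
    qed
  qed
  then have "x \<rightarrow>\<^sup>*\<^bsub>del_arc a\<^esub> y" if "x \<rightarrow>\<^sup>* y" for x y
    using reachable_if_arcs_reachable[OF that H.wf_digraph_axioms] by simp
  with strong show "strongly_connected (del_arc a)"
    by (simp add: strongly_connected_def)
qed

lemma del_parc_simps [simp]:
  "pverts (del_parc G a) = pverts G"
  "parcs (del_parc G a) = parcs G - {a}"
  by (simp_all add: del_parc_def)

lemma with_proj_del_parc:
  "with_proj (del_parc G a) = pre_digraph.del_arc (with_proj G) a"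
  by (simp add: with_proj_def del_parc_def pre_digraph.del_arc_def)

lemma add_parc_simps [simp]:
  "pverts (add_parc G a) = pverts G"
  "parcs (add_parc G a) = insert a (parcs G)"
  by (simp_all add: add_parc_def)

lemma external_expansion_simps [simp]:
  "pverts (external_expansion G u w v) = insert v (pverts G)"
  "parcs (external_expansion G u w v) = parcs G \<union> {(u, v), (v, w)}"
  by (simp_all add: external_expansion_def)

lemma del_parc_add_parc_commute:
  "a \<noteq> b \<Longrightarrow> del_parc (add_parc G b) a = add_parc (del_parc G a) b"
  by (auto simp: del_parc_def add_parc_def)

lemma del_parc_external_expansion_commute:
  "a \<notin> {(u, v), (v, w)} \<Longrightarrow>
    del_parc (external_expansion G u w v) a = external_expansion (del_parc G a) u w v"
  by (auto simp: del_parc_def external_expansion_def)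

context pair_wf_digraph
begin

lemma pair_wf_digraph_del_parc: "pair_wf_digraph (del_parc G a)"
  by unfold_locales (auto dest: wellformed')

lemma pair_wf_digraph_add_parc:
  "x \<in> pverts G \<Longrightarrow> y \<in> pverts G \<Longrightarrow> pair_wf_digraph (add_parc G (x, y))"
  by unfold_locales (auto dest: wellformed')

lemma pair_wf_digraph_external_expansion:
  "u \<in> pverts G \<Longrightarrow> w \<in> pverts G \<Longrightarrow> pair_wf_digraph (external_expansion G u w v)"
  by unfold_locales (auto dest: wellformed')

lemma transitive_arc_iff_reachable_del_parc:
  "transitive_arc G a \<longleftrightarrow> a \<in> parcs G \<and> fst a \<rightarrow>\<^sup>*\<^bsub>with_proj (del_parc G a)\<^esub> snd a"
  by (simp add: transitive_arc_def with_proj_del_parc reachable_del_arc_iff_other_apath)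

lemma strongly_connected_del_parc_iff_transitive_arc:
  assumes "strongly_connected (with_proj G)" "a \<in> parcs G"
  shows "strongly_connected (with_proj (del_parc G a)) \<longleftrightarrow> transitive_arc G a"
  using assms strongly_connected_del_arc_iff[of a]
  by (simp add: transitive_arc_iff_reachable_del_parc with_proj_del_parc)

lemma transitive_arc_imp_trancl_minus:
  assumes "transitive_arc G (x, y)" and "x \<noteq> y"
  shows "(x, y) \<in> (parcs G - {(x, y)})\<^sup>+"
proof -
  interpret H: pair_wf_digraph "del_parc G (x, y)" by (rule pair_wf_digraph_del_parc)
  show ?thesis
    using assms H.reachable_neq_reachable1 by (simp add: transitive_arc_iff_reachable_del_parc)
qed

lemma not_transitive_arc_if_only_in_arc:
  assumes "x \<noteq> y" and "\<And>z. (z, y) \<in> parcs G \<Longrightarrow> z = x"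
  shows "\<not> transitive_arc G (x, y)"
  using assms by (blast dest: transitive_arc_imp_trancl_minus tranclD2)

lemma not_transitive_arc_if_only_out_arc:
  assumes "x \<noteq> y" and "\<And>z. (x, z) \<in> parcs G \<Longrightarrow> z = y"
  shows "\<not> transitive_arc G (x, y)"
  using assms by (blast dest: transitive_arc_imp_trancl_minus tranclD)

lemma strongly_connected_external_expansion:
  assumes strong: "strongly_connected (with_proj G)" and u_vert: "u \<in> pverts G" and w_vert: "w \<in> pverts G"
  shows "strongly_connected (with_proj (external_expansion G u w v))" (is "strongly_connected ?E")
proof -
  interpret E: pair_wf_digraph "external_expansion G u w v"
    using u_vert w_vert by (rule pair_wf_digraph_external_expansion)
  have "subgraph (with_proj G) ?E"
    using wf_digraph_axioms E.wf_digraph_axioms by (intro subgraphI) auto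
  then have reach_old: "x \<rightarrow>\<^sup>*\<^bsub>?E\<^esub> y" if "x \<in> pverts G" "y \<in> pverts G" for x y
    using strong that by (auto simp: strongly_connected_def intro: E.reachable_mono)
  have "v \<rightarrow>\<^sup>*\<^bsub>?E\<^esub> u"
    using E.adj_reachable_trans[of v w u] reach_old u_vert w_vert by simp
  moreover have "u \<rightarrow>\<^sup>*\<^bsub>?E\<^esub> v"
    by (simp add: E.reachable_adjI)
  ultimately have "x \<rightarrow>\<^sup>*\<^bsub>?E\<^esub> u \<and> u \<rightarrow>\<^sup>*\<^bsub>?E\<^esub> x" if "x \<in> verts ?E" for x
    using reach_old u_vert that by auto
  then show ?thesis
    by (intro strongly_connectedI) (auto intro: E.reachable_trans)
qed

lemma reachable_external_expansion_iff:
  assumes u_vert: "u \<in> pverts G" and w_vert: "w \<in> pverts G" and v_new: "v \<notin> pverts G"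
    and x_vert: "x \<in> pverts G" and y_vert: "y \<in> pverts G"
  shows "x \<rightarrow>\<^sup>*\<^bsub>with_proj (external_expansion G u w v)\<^esub> y \<longleftrightarrow>
    x \<rightarrow>\<^sup>*\<^bsub>with_proj (add_parc G (u, w))\<^esub> y" (is "x \<rightarrow>\<^sup>*\<^bsub>?E\<^esub> y \<longleftrightarrow> x \<rightarrow>\<^sup>*\<^bsub>?P\<^esub> y")
proof -
  interpret E: pair_wf_digraph "external_expansion G u w v"
    using u_vert w_vert by (rule pair_wf_digraph_external_expansion)
  interpret P: pair_wf_digraph "add_parc G (u, w)"
    using u_vert w_vert by (rule pair_wf_digraph_add_parc)
  show ?thesis
  proof
    \<comment> \<open>Contracting \<open>uv\<close> turns the expansion into \<open>G + uw\<close>.\<close>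
    let ?f = "\<lambda>z. if z = v then u else z"
    assume "x \<rightarrow>\<^sup>*\<^bsub>?E\<^esub> y"
    then have "?f x \<rightarrow>\<^sup>*\<^bsub>?P\<^esub> ?f y"
    proof (rule E.reachable_image)
      show "?f y \<rightarrow>\<^sup>*\<^bsub>?P\<^esub> ?f z" if "(y, z) \<in> parcs (external_expansion G u w v)" for y z
        using that u_vert w_vert v_new by (auto dest: wellformed')
    qed (use u_vert P.wf_digraph_axioms in auto)
    moreover have "x \<noteq> v" "y \<noteq> v" using x_vert y_vert v_new by auto
    ultimately show "x \<rightarrow>\<^sup>*\<^bsub>?P\<^esub> y" by simp
  next
    have detour: "u \<rightarrow>\<^sup>*\<^bsub>?E\<^esub> w"
      using E.adj_reachable_trans[of u v w] by simp
    assume "x \<rightarrow>\<^sup>*\<^bsub>?P\<^esub> y"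
    then show "x \<rightarrow>\<^sup>*\<^bsub>?E\<^esub> y"
    proof (rule P.reachable_if_arcs_reachable)
      show "y \<rightarrow>\<^sup>*\<^bsub>?E\<^esub> z" if "(y, z) \<in> parcs (add_parc G (u, w))" for y z
        using that detour by auto
    qed (use E.wf_digraph_axioms in auto)
  qed
qed

lemma transitive_arc_external_expansion_iff:
  assumes u_vert: "u \<in> pverts G" and w_vert: "w \<in> pverts G" and v_new: "v \<notin> pverts G"
    and uw_new: "(u, w) \<notin> parcs G"
  shows "transitive_arc (external_expansion G u w v) a \<longleftrightarrow>
    transitive_arc (add_parc G (u, w)) a \<and> a \<noteq> (u, w)"
proof -
  interpret E: pair_wf_digraph "external_expansion G u w v"
    using u_vert w_vert by (rule pair_wf_digraph_external_expansion)
  interpret P: pair_wf_digraph "add_parc G (u, w)"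
    using u_vert w_vert by (rule pair_wf_digraph_add_parc)
  interpret H: pair_wf_digraph "del_parc G a" by (rule pair_wf_digraph_del_parc)
  have fresh: "(u, v) \<notin> parcs G" "(v, w) \<notin> parcs G" "u \<noteq> v" "v \<noteq> w"
    using u_vert w_vert v_new by (auto dest: wellformed')
  have "transitive_arc (external_expansion G u w v) a \<longleftrightarrow> transitive_arc (add_parc G (u, w)) a"
    if a_arc: "a \<in> parcs G"
  proof -
    have "a \<notin> {(u, v), (v, w)}" "a \<noteq> (u, w)" using a_arc fresh uw_new by auto
    then show ?thesis
      using a_arc u_vert w_vert v_new
      by (simp add: E.transitive_arc_iff_reachable_del_parc P.transitive_arc_iff_reachable_del_parc
          del_parc_external_expansion_commute del_parc_add_parc_commute
          H.reachable_external_expansion_iff arc_fst_in_verts arc_snd_in_verts)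
  qed
  moreover have "\<not> transitive_arc (external_expansion G u w v) (u, v)"
    using fresh v_new by (intro E.not_transitive_arc_if_only_in_arc) (auto dest: wellformed')
  moreover have "\<not> transitive_arc (external_expansion G u w v) (v, w)"
    using fresh v_new by (intro E.not_transitive_arc_if_only_out_arc) (auto dest: wellformed')
  ultimately show ?thesis
    using fresh uw_new by (auto simp: transitive_arc_def)
qed

end

context pair_digraph
begin

lemma pair_digraph_external_expansion:
  assumes "u \<in> pverts G" "w \<in> pverts G" "v \<notin> pverts G"
  shows "pair_digraph (external_expansion G u w v)"
  using assms pair_finite_verts pair_finite_arcs
  by unfold_locales (auto dest: wellformed' no_loops')

lemma minimal_strong_iff_no_transitive_arc:
  "minimal_strong G \<longleftrightarrow> strongly_connected (with_proj G) \<and> (\<nexists>a. transitive_arc G a)"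
  using strongly_connected_del_parc_iff_transitive_arc
  by (auto simp: minimal_strong_def transitive_arc_def pair_digraph)

end

theorem theorem3p3:
  fixes D :: "'a pair_pre_digraph" and u w v :: 'a
  assumes "minimal_strong D"
    and "u \<in> pverts D" and "w \<in> pverts D" and "u \<noteq> w"
    and "(u, w) \<notin> parcs D"
    and "v \<notin> pverts D"
  shows "minimal_strong (external_expansion D u w v) \<longleftrightarrow>
    \<not> (\<exists>a. transitive_arc (add_parc D (u, w)) a \<and> a \<noteq> (u, w))"
proof -
  interpret D: pair_digraph D
    using assms(1) by (simp add: minimal_strong_def)
  interpret E: pair_digraph "external_expansion D u w v"
    using assms by (intro D.pair_digraph_external_expansion)
  have "strongly_connected (with_proj (external_expansion D u w v))"
    using assms by (intro D.strongly_connected_external_expansion) (simp_all add: minimal_strong_def)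
  then have "minimal_strong (external_expansion D u w v) \<longleftrightarrow>
      (\<nexists>a. transitive_arc (external_expansion D u w v) a)"
    by (simp add: E.minimal_strong_iff_no_transitive_arc)
  also have "\<dots> \<longleftrightarrow> \<not> (\<exists>a. transitive_arc (add_parc D (u, w)) a \<and> a \<noteq> (u, w))"
    using assms by (simp add: D.transitive_arc_external_expansion_iff)
  finally show ?thesis .
qed

end
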